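(* Let $C$ be a smooth planar curve with at most cusp singularities. Let $\mathbb E(C)$ be its extended evolutoids front, $\Sigma(\mathbb E(C))$ the set of singular points of $\mathbb E(C)$, and $\pi:\mathbb R\times\mathbb R^2\to\mathbb R^2$, $\pi(\alpha,x)=x$. Then $$\pi\big(\Sigma(\mathbb E(C))\big)=SES(C),$$ where $SES(C)$ is the singular evolutoids set of $C$.
   Context: A smooth planar curve is the image of a $C^\infty$ map $f_C$ from an interval to $\mathbb R^2$. A singular point ($f_C'=0$) is a cusp if $f_C'',f_C'''$ are linearly independent there. $\rho_C,t_C,n_C$ denote the signed radius of curvature, unit tangent and unit normal, $(t_C,n_C)$ positively oriented; at a cusp the radius of curvature is $0$ and the tangent line is the limiting line. For $\alpha\in[0,\pi]$ the $\alpha$-evolutoid $\mathcal E_\alpha(C)$ is the envelope of the lines obtained by rotating each tangent line of $C$ about its point of tangency by the angle $\alpha$ counterclockwise. It is parameterized by $\gamma_\alpha(s)=f_C(s)+\rho_C(s)\sin\alpha\cos\alpha\; t_C(s)+\rho_C(s)\sin^2\alpha\; n_C(s)$, where $s$ is a smooth parameter of $C$, and its singular points are understood as singular points of this parameterization (or an equivalent one). The singular evolutoids set $SES(C)$ is the set of all singular points of all $\mathcal E_\alpha(C)$ for $\alpha\in[0,\pi]$. The extended evolutoids front is $\mathbb E(C)=\bigcup_{\alpha\in[0,\pi]}\{\alpha\}\times\mathcal E_\alpha(C)\subset\mathbb R\times\mathbb R^2$, parameterized by $(\alpha,s)\mapsto(\alpha,\gamma_\alpha(s))$; its singular points are the image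 points at which the differential of this parameterization has rank less than $2$. *)

theory Defs
  imports "HOL-Analysis.Analysis"
begin

text \<open>A planar curve is given by a map \<open>f\<close> on an interval \<open>I\<close>. All derivatives are taken within
  the domain, so they are one-sided at an end point that belongs to \<open>I\<close>.\<close>

primrec curve_deriv :: "(real \<Rightarrow> real^2) \<Rightarrow> real set \<Rightarrow> nat \<Rightarrow> real \<Rightarrow> real^2" where
  "curve_deriv f I 0 = f"
| "curve_deriv f I (Suc n) = (\<lambda>s. vector_derivative (curve_deriv f I n) (at s within I))"

definition smooth_curve :: "(real \<Rightarrow> real^2) \<Rightarrow> real set \<Rightarrow> bool" where
  "smooth_curve f I \<longleftrightarrow>
     is_interval I \<and> (\<exists>a\<in>I. \<exists>b\<in>I. a < b) \<and> (\<forall>n. curve_deriv f I n differentiable_on I)"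

text \<open>The distinctness conjunct is needed because \<open>independent\<close> speaks about a set of vectors.\<close>

definition is_cusp :: "(real \<Rightarrow> real^2) \<Rightarrow> real set \<Rightarrow> real \<Rightarrow> bool" where
  "is_cusp f I s \<longleftrightarrow> curve_deriv f I 1 s = 0 \<and>
     curve_deriv f I 2 s \<noteq> curve_deriv f I 3 s \<and>
     independent {curve_deriv f I 2 s, curve_deriv f I 3 s}"

definition at_most_cusps :: "(real \<Rightarrow> real^2) \<Rightarrow> real set \<Rightarrow> bool" where
  "at_most_cusps f I \<longleftrightarrow> (\<forall>s\<in>I. curve_deriv f I 1 s = 0 \<longrightarrow> is_cusp f I s)"

definition det2 :: "real^2 \<Rightarrow> real^2 \<Rightarrow> real" where
  "det2 v w = v$1 * w$2 - v$2 * w$1"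

definition rot90 :: "real^2 \<Rightarrow> real^2" where
  "rot90 v = vector [- v$2, v$1]"

text \<open>At a cusp the limiting tangent line is spanned by the second derivative. Away from cusps the
  frame is oriented by the velocity, so it is reversed when a cusp is crossed; the signed radius of
  curvature changes sign with it, and only the products \<open>\<rho> t\<close> and \<open>\<rho> n\<close>, which do not depend on the
  orientation, enter the parameterization of the evolutoids.\<close>

definition unit_tangent :: "(real \<Rightarrow> real^2) \<Rightarrow> real set \<Rightarrow> real \<Rightarrow> real^2" where
  "unit_tangent f I s =
     (if curve_deriv f I 1 s \<noteq> 0 then sgn (curve_deriv f I 1 s) else sgn (curve_deriv f I 2 s))"

definition unit_normal :: "(real \<Rightarrow> real^2) \<Rightarrow> real set \<Rightarrow> real \<Rightarrow> real^2" where
  "unit_normal f I s = rot90 (unit_tangent f I s)"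

definition curvature_radius :: "(real \<Rightarrow> real^2) \<Rightarrow> real set \<Rightarrow> real \<Rightarrow> real" where
  "curvature_radius f I s =
     (if curve_deriv f I 1 s = 0 then 0
      else norm (curve_deriv f I 1 s) ^ 3 / det2 (curve_deriv f I 1 s) (curve_deriv f I 2 s))"

text \<open>At an inflection point of a regular piece the radius of curvature is infinite and
  \<open>\<gamma>\<^sub>\<alpha>\<close> is undefined, so such parameters do not belong to the domain of the parameterizations.
  Cusps do belong to it.\<close>

definition finite_radius_domain :: "(real \<Rightarrow> real^2) \<Rightarrow> real set \<Rightarrow> real set" where
  "finite_radius_domain f I =
     {s \<in> I. curve_deriv f I 1 s = 0 \<or> det2 (curve_deriv f I 1 s) (curve_deriv f I 2 s) \<noteq> 0}"

definition evolutoid_param :: "(real \<Rightarrow> real^2) \<Rightarrow> real set \<Rightarrow> real \<Rightarrow> real \<Rightarrow> real^2" where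
  "evolutoid_param f I \<alpha> s =
     f s + (curvature_radius f I s * sin \<alpha> * cos \<alpha>) *\<^sub>R unit_tangent f I s
         + (curvature_radius f I s * (sin \<alpha>)\<^sup>2) *\<^sub>R unit_normal f I s"

definition evolutoid :: "(real \<Rightarrow> real^2) \<Rightarrow> real set \<Rightarrow> real \<Rightarrow> (real^2) set" where
  "evolutoid f I \<alpha> = evolutoid_param f I \<alpha> ` finite_radius_domain f I"

definition evolutoid_singular_points :: "(real \<Rightarrow> real^2) \<Rightarrow> real set \<Rightarrow> real \<Rightarrow> (real^2) set" where
  "evolutoid_singular_points f I \<alpha> =
     {x \<in> evolutoid f I \<alpha>. \<exists>s \<in> finite_radius_domain f I. x = evolutoid_param f I \<alpha> s \<and>
        (evolutoid_param f I \<alpha> has_vector_derivative 0) (at s within finite_radius_domain f I)}"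

definition SES :: "(real \<Rightarrow> real^2) \<Rightarrow> real set \<Rightarrow> (real^2) set" where
  "SES f I = (\<Union>\<alpha>\<in>{0..pi}. evolutoid_singular_points f I \<alpha>)"

definition extended_front :: "(real \<Rightarrow> real^2) \<Rightarrow> real set \<Rightarrow> (real \<times> (real^2)) set" where
  "extended_front f I = (\<Union>\<alpha>\<in>{0..pi}. {\<alpha>} \<times> evolutoid f I \<alpha>)"

definition front_param :: "(real \<Rightarrow> real^2) \<Rightarrow> real set \<Rightarrow> real \<times> real \<Rightarrow> real \<times> (real^2)" where
  "front_param f I = (\<lambda>(\<alpha>, s). (\<alpha>, evolutoid_param f I \<alpha> s))"

definition front_domain :: "(real \<Rightarrow> real^2) \<Rightarrow> real set \<Rightarrow> (real \<times> real) set" where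
  "front_domain f I = {0..pi} \<times> finite_radius_domain f I"

lemma extended_front_eq_image: "extended_front f I = front_param f I ` front_domain f I"
  by (force simp: extended_front_def evolutoid_def front_param_def front_domain_def)

text \<open>The rank of a linear map is the dimension of its range.\<close>

definition front_singular_points :: "(real \<Rightarrow> real^2) \<Rightarrow> real set \<Rightarrow> (real \<times> (real^2)) set" where
  "front_singular_points f I =
     {p \<in> extended_front f I. \<exists>q \<in> front_domain f I. p = front_param f I q \<and>
        (\<exists>F. (front_param f I has_derivative F) (at q within front_domain f I) \<and>
             dim (range F) < 2)}"

end

theory Submission
  imports Defs
begin

text \<open>Write \<open>\<gamma>\<^sub>\<alpha> = f + sin \<alpha> \<cdot> R\<^sub>\<alpha> h\<close> with \<open>h = \<rho> t\<close> and \<open>R\<^sub>\<alpha>\<close> the rotation by \<open>\<alpha>\<close>. The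
  differential of the front sends \<open>\<partial>\<^sub>\<alpha>\<close> to a vector with first entry \<open>1\<close> and \<open>\<partial>\<^sub>s\<close> to
  \<open>(0, \<gamma>\<^sub>\<alpha>')\<close>, so its rank drops exactly if \<open>\<gamma>\<^sub>\<alpha>' = 0\<close>. What needs care is that a singular point
  of a single evolutoid makes the front differentiable. If \<open>sin \<alpha> \<noteq> 0\<close>, then \<open>h\<close> can be recovered
  from \<open>\<gamma>\<^sub>\<alpha> - f\<close>, and is therefore as differentiable as \<open>\<gamma>\<^sub>\<alpha>\<close>. If \<open>sin \<alpha> = 0\<close>, then \<open>\<gamma>\<^sub>\<alpha> = f\<close>, so
  the parameter is a cusp; there it suffices that \<open>h\<close> tends to \<open>0\<close>, since \<open>h\<close> is multiplied by
  \<open>sin \<alpha>\<close>.\<close>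

section \<open>Quarter turn and determinant\<close>

lemma rot90_nth [simp]: "rot90 v $ 1 = - v $ 2" "rot90 v $ 2 = v $ 1"
  by (simp_all add: rot90_def)

lemma norm_rot90 [simp]: "norm (rot90 v) = norm v"
  by (simp add: norm_eq_sqrt_inner inner_vec_def sum_2 add.commute)

lemma linear_rot90: "linear rot90"
  by (rule linearI) (simp_all add: vec_eq_iff forall_2)

lemma bounded_linear_rot90: "bounded_linear rot90"
  using linear_rot90 by (simp add: linear_conv_bounded_linear)

lemma rot90_scaleR: "rot90 (c *\<^sub>R v) = c *\<^sub>R rot90 v"
  by (simp add: linear_cmul[OF linear_rot90])

lemma det2_eq_inner: "det2 v w = rot90 v \<bullet> w"
  by (simp add: det2_def inner_vec_def sum_2)

lemma det2_self [simp]: "det2 v v = 0"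
  by (simp add: det2_def)

lemma det2_zero_left [simp]: "det2 0 w = 0"
  by (simp add: det2_def)

lemma tendsto_det2 [tendsto_intros]:
  assumes "(u \<longlongrightarrow> a) F" and "(v \<longlongrightarrow> b) F"
  shows "((\<lambda>x. det2 (u x) (v x)) \<longlongrightarrow> det2 a b) F"
  unfolding det2_eq_inner
  by (intro tendsto_inner bounded_linear.tendsto[OF bounded_linear_rot90] assms)

lemma has_vector_derivative_det2:
  assumes "(u has_vector_derivative u') (at x within S)"
    and "(v has_vector_derivative v') (at x within S)"
  shows "((\<lambda>x. det2 (u x) (v x)) has_vector_derivative (det2 (u x) v' + det2 u' (v x))) (at x within S)"
  unfolding det2_eq_inner
  by (intro bounded_bilinear.has_vector_derivative[OF bounded_bilinear_inner]
      bounded_linear.has_vector_derivative[OF bounded_linear_rot90] assms)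

text \<open>A vanishing determinant makes \<open>w\<close> a multiple of \<open>v\<close>, with a
  factor that can be read off from any nonzero coordinate of \<open>v\<close>.\<close>

lemma independent_imp_det2_nonzero:
  assumes "v \<noteq> w" and "independent {v, w}"
  shows "det2 v w \<noteq> 0"
proof
  assume det: "det2 v w = 0"
  have "v \<noteq> 0"
    using assms(2) dependent_zero by blast
  have "independent (insert w {v})"
    using assms(2) by (simp add: insert_commute)
  then have notin: "w \<notin> span {v}"
    using assms(1) by (metis independent_insert singletonD)
  have "v $ 1 \<noteq> 0 \<or> v $ 2 \<noteq> 0"
    using \<open>v \<noteq> 0\<close> by (auto simp: vec_eq_iff forall_2)
  then have "\<exists>k. w = k *\<^sub>R v"
  proof
    assume "v $ 1 \<noteq> 0"
    then have "w = (w $ 1 / v $ 1) *\<^sub>R v"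
      using det by (simp add: vec_eq_iff forall_2 det2_def field_simps)
    then show ?thesis ..
  next
    assume "v $ 2 \<noteq> 0"
    then have "w = (w $ 2 / v $ 2) *\<^sub>R v"
      using det by (simp add: vec_eq_iff forall_2 det2_def field_simps)
    then show ?thesis ..
  qed
  with notin show False
    by (auto simp: span_singleton)
qed

section \<open>Derivatives within a set\<close>

text \<open>The library form divides the remainder by \<open>norm (y - x)\<close> instead of
  \<open>y - x\<close>; the two quotients differ by a sign at most, so their norms agree. Both sides
  hold trivially if \<open>x\<close> is isolated in \<open>S\<close>.\<close>

lemma has_vector_derivative_tendsto_quotient:
  "(g has_vector_derivative g') (at x within S) \<longleftrightarrow>
     ((\<lambda>y. (g y - g x) /\<^sub>R (y - x)) \<longlongrightarrow> g') (at x within S)"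
  for g :: "real \<Rightarrow> 'a::real_normed_vector"
proof -
  have "((\<lambda>y. (g y - g x) /\<^sub>R (y - x)) \<longlongrightarrow> g') (at x within S) \<longleftrightarrow>
        ((\<lambda>y. norm ((g y - g x) /\<^sub>R (y - x) - g')) \<longlongrightarrow> 0) (at x within S)"
    by (subst Lim_null) (rule tendsto_norm_zero_iff[symmetric])
  also have "\<dots> \<longleftrightarrow> ((\<lambda>y. norm ((g y - (g x + (y - x) *\<^sub>R g')) /\<^sub>R norm (y - x))) \<longlongrightarrow> 0) (at x within S)"
  proof (rule tendsto_cong, unfold eventually_at_topological, intro exI[of _ UNIV] conjI ballI impI)
    fix y assume "y \<noteq> x"
    then have "(g y - g x) /\<^sub>R (y - x) - g' = (g y - (g x + (y - x) *\<^sub>R g')) /\<^sub>R (y - x)"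
      by (simp add: scaleR_right_diff_distrib scaleR_right_distrib)
    then show "norm ((g y - g x) /\<^sub>R (y - x) - g') = norm ((g y - (g x + (y - x) *\<^sub>R g')) /\<^sub>R norm (y - x))"
      by simp
  qed auto
  also have "\<dots> \<longleftrightarrow> (g has_vector_derivative g') (at x within S)"
    unfolding has_vector_derivative_def has_derivative_within tendsto_norm_zero_iff inverse_eq_divide
    using bounded_linear_scaleR_left[of g'] by blast
  finally show ?thesis ..
qed

text \<open>A factor of first order times a factor tending to 0 is of smaller order than the
  distance. Neither factor has to be differentiable, which is what the cusp case calls for.\<close>

lemma has_derivative_zero_if_bounded:
  assumes "g x = 0" and bound: "\<And>y. y \<in> S \<Longrightarrow> norm (g y) \<le> norm (y - x) * r y"
    and r: "(r \<longlongrightarrow> 0) (at x within S)"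
  shows "(g has_derivative (\<lambda>_. 0)) (at x within S)"
  unfolding has_derivative_within
proof
  have "\<forall>\<^sub>F y in at x within S. norm ((1 / norm (y - x)) *\<^sub>R (g y - (g x + 0))) \<le> r y"
    unfolding eventually_at_topological
  proof (intro exI[of _ UNIV] conjI ballI impI)
    fix y assume "y \<noteq> x" "y \<in> S"
    then show "norm ((1 / norm (y - x)) *\<^sub>R (g y - (g x + 0))) \<le> r y"
      using bound[of y] \<open>g x = 0\<close> by (simp add: field_simps)
  qed auto
  then show "((\<lambda>y. (1 / norm (y - x)) *\<^sub>R (g y - (g x + 0))) \<longlongrightarrow> 0) (at x within S)"
    using r by (rule Lim_null_comparison)
qed simp

text \<open>Turns the shape of the differential found at singular parameters into the drop of
  rank.\<close>

lemma dim_range_scaleR_le_1: "dim (range (\<lambda>x. g x *\<^sub>R v)) \<le> 1"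
proof -
  have "dim (range (\<lambda>x. g x *\<^sub>R v)) \<le> card {v}"
    by (rule dim_le_card) (auto simp: span_singleton)
  then show ?thesis by simp
qed

lemma has_vector_derivative_curve_deriv:
  assumes "smooth_curve f I" and "s \<in> I"
  shows "(curve_deriv f I n has_vector_derivative curve_deriv f I (Suc n) s) (at s within I)"
  using assms
  by (simp add: smooth_curve_def differentiable_on_def flip: vector_derivative_works)

text \<open>A connected set with more than one point has no isolated points. This gives uniqueness
  of derivatives within \<open>I\<close>, end points included.\<close>

lemma at_within_smooth_curve_nonbot:
  assumes "smooth_curve f I" and "s \<in> I"
  shows "at s within I \<noteq> bot"
proof -
  obtain a b where "is_interval I" "a \<in> I" "b \<in> I" "a < b"
    using assms(1) by (auto simp: smooth_curve_def)
  then have "connected I" "I \<noteq> {s}"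
    by (auto simp: is_interval_connected_1)
  then have "s islimpt I"
    using assms(2) connected_imp_perfect by blast
  then show ?thesis
    by (simp add: trivial_limit_within)
qed

section \<open>The radius of curvature at a cusp\<close>

text \<open>At a cusp \<open>f1\<close> vanishes to first order, while \<open>d = det2 f1 f2\<close>
  has derivative \<open>e = det2 f1 f3\<close>, which behaves like \<open>K * (x - c)\<close>. So
  \<open>d\<close> is of exact order 2, and the quotient of \<open>norm f1 ^ 3\<close> by it is of
  order 1.\<close>

lemma curvature_radius_tendsto_0_at_cusp:
  assumes smooth: "smooth_curve f I" and c: "c \<in> I" and cusp: "is_cusp f I c"
  shows "(curvature_radius f I \<longlongrightarrow> 0) (at c within I)"
proof -
  note D = has_vector_derivative_curve_deriv[OF smooth]
  define f1 where "f1 = curve_deriv f I 1"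
  define f2 where "f2 = curve_deriv f I 2"
  define f3 where "f3 = curve_deriv f I 3"
  define d where "d s = det2 (f1 s) (f2 s)" for s
  define e where "e s = det2 (f1 s) (f3 s)" for s
  define K where "K = det2 (f2 c) (f3 c)"
  have f1c: "f1 c = 0" and K: "K \<noteq> 0"
    using cusp by (auto simp: is_cusp_def f1_def f2_def f3_def K_def independent_imp_det2_nonzero)
  have f1': "(f1 has_vector_derivative f2 s) (at s within I)"
    and f2': "(f2 has_vector_derivative f3 s) (at s within I)"
    and f3': "\<exists>v. (f3 has_vector_derivative v) (at s within I)" if "s \<in> I" for s
    using D[OF that, of 1] D[OF that, of 2] D[OF that, of 3]
    by (auto simp: f1_def f2_def f3_def numeral_2_eq_2 numeral_3_eq_3)
  have d': "(d has_vector_derivative e s) (at s within I)" if "s \<in> I" for s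
    using has_vector_derivative_det2[OF f1'[OF that] f2'[OF that]]
    by (simp add: d_def[abs_def] e_def)
  have e': "(e has_vector_derivative K) (at c within I)"
  proof -
    obtain v where "(f3 has_vector_derivative v) (at c within I)"
      using f3'[OF c] ..
    from has_vector_derivative_det2[OF f1'[OF c] this] show ?thesis
      by (simp add: e_def[abs_def] K_def f1c)
  qed
  have ec: "e c = 0" and dc: "d c = 0"
    by (simp_all add: e_def d_def f1c)
  \<comment> \<open>Multiplication by \<open>K\<close> makes the limit positive, so that both signs
    of \<open>K\<close> are treated at once.\<close>
  have "((\<lambda>x. K * (e x / (x - c))) \<longlongrightarrow> K * K) (at c within I)"
    using e' by (intro tendsto_mult_left)
      (simp add: has_vector_derivative_tendsto_quotient ec divide_inverse_commute)
  moreover have "K * K / 2 < K * K"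
    using K by (simp add: zero_less_mult_iff linorder_neq_iff disj_commute)
  ultimately have "\<forall>\<^sub>F x in at c within I. K * K / 2 < K * (e x / (x - c))"
    by (rule order_tendstoD)
  then obtain \<delta> where \<delta>: "\<delta> > 0"
    and e_lower: "\<And>x. x \<in> I \<Longrightarrow> x \<noteq> c \<Longrightarrow> dist x c < \<delta> \<Longrightarrow> K * K / 2 < K * (e x / (x - c))"
    by (auto simp: eventually_at)

  \<comment> \<open>The coefficient \<open>K * K / 4\<close> is chosen so that
    \<open>\<psi>'\<close> subtracts \<open>K * K / 2 * (x - c)\<close>, which is exactly what
    \<open>e_lower\<close> controls.\<close>
  define \<psi> where "\<psi> x = K * d x - K * K / 4 * (x - c)\<^sup>2" for x
  define \<psi>' where "\<psi>' x = K * e x - K * K / 2 * (x - c)" for x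
  have \<psi>_deriv: "(\<psi> has_derivative (\<lambda>t. t * \<psi>' x)) (at x within T)" if "x \<in> I" "T \<subseteq> I" for x T
  proof -
    have "(d has_real_derivative e x) (at x within T)"
      using has_vector_derivative_within_subset[OF d'[OF that(1)] that(2)]
      by (simp add: has_real_derivative_iff_has_vector_derivative)
    then have "(\<psi> has_real_derivative \<psi>' x) (at x within T)"
      unfolding \<psi>_def[abs_def] \<psi>'_def
      by (auto intro!: derivative_eq_intros)
    then show ?thesis
      by (simp add: has_field_derivative_def mult.commute[of _ "\<psi>' x"])
  qed
  have \<psi>c: "\<psi> c = 0"
    by (simp add: \<psi>_def dc)
  have sub: "{a..b} \<subseteq> I" if "a \<in> I" "b \<in> I" for a b
    using smooth that mem_is_interval_1_I[of I a b] unfolding smooth_curve_def by auto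
  have d_lower: "K * K / 4 * (x - c)\<^sup>2 \<le> K * d x" if x: "x \<in> I" "dist x c < \<delta>" for x
  proof -
    \<comment> \<open>By \<open>e_lower\<close>, \<open>\<psi>'\<close> has the sign of
      \<open>z - c\<close> near \<open>c\<close>; the mean value theorem on either side shows that
      \<open>\<psi>\<close> has a minimum with value 0 at \<open>c\<close>.\<close>
    consider "x = c" | "c < x" | "x < c" by linarith
    then have "\<psi> x \<ge> 0"
    proof cases
      case 1
      then show ?thesis by (simp add: \<psi>c)
    next
      case 2
      obtain z where z: "z \<in> {c<..<x}" "\<psi> x - \<psi> c = (x - c) * \<psi>' z"
        using mvt_simple[OF 2 \<psi>_deriv[OF _ sub[OF c x(1)]]] sub[OF c x(1)]
        by (metis atLeastAtMost_iff subsetD)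
      have "z \<in> I" using sub[OF c x(1)] z(1) by auto
      with z(1) x(2) have "K * K / 2 < K * (e z / (z - c))"
        by (intro e_lower) (auto simp: dist_real_def)
      with z(1) have "\<psi>' z > 0"
        by (simp add: \<psi>'_def field_simps)
      with z(2) 2 show ?thesis by (simp add: \<psi>c)
    next
      case 3
      obtain z where z: "z \<in> {x<..<c}" "\<psi> c - \<psi> x = (c - x) * \<psi>' z"
        using mvt_simple[OF 3 \<psi>_deriv[OF _ sub[OF x(1) c]]] sub[OF x(1) c]
        by (metis atLeastAtMost_iff subsetD)
      have "z \<in> I" using sub[OF x(1) c] z(1) by auto
      with z(1) x(2) have "K * K / 2 < K * (e z / (z - c))"
        by (intro e_lower) (auto simp: dist_real_def)
      with z(1) have "\<psi>' z < 0"
        by (simp add: \<psi>'_def field_simps)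
      with 3 have "(c - x) * \<psi>' z < 0"
        by (simp add: mult_pos_neg)
      with z(2) show ?thesis by (simp add: \<psi>c)
    qed
    then show ?thesis by (simp add: \<psi>_def)
  qed

  \<comment> \<open>Two of the three factors \<open>norm (f1 x)\<close> absorb the
    \<open>(x - c)\<^sup>2\<close> from the bound on \<open>d\<close> and become difference
    quotients with limit \<open>f2 c\<close>; the third tends to 0.\<close>
  have "\<bar>curvature_radius f I x\<bar> \<le> 4 / \<bar>K\<bar> * norm (f1 x) * (norm (f1 x /\<^sub>R (x - c)))\<^sup>2"
    if x: "x \<in> I" "x \<noteq> c" "dist x c < \<delta>" for x
  proof (cases "f1 x = 0")
    case True
    then show ?thesis by (simp add: curvature_radius_def f1_def)
  next
    case False
    define m where "m = \<bar>K\<bar> / 4 * (x - c)\<^sup>2"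
    have "m > 0" using K x(2) by (simp add: m_def)
    have "\<bar>K\<bar> * m = K * K / 4 * (x - c)\<^sup>2"
      unfolding m_def abs_mult_self_eq[of K, symmetric] by simp
    also have "\<dots> \<le> K * d x"
      using x(1,3) by (rule d_lower)
    also have "\<dots> \<le> \<bar>K\<bar> * \<bar>d x\<bar>"
      by (simp flip: abs_mult)
    finally have "m \<le> \<bar>d x\<bar>"
      using K by simp
    then have "norm (f1 x) ^ 3 / \<bar>d x\<bar> \<le> norm (f1 x) ^ 3 / m"
      using \<open>m > 0\<close> by (intro divide_left_mono) auto
    also have "\<dots> = 4 / \<bar>K\<bar> * norm (f1 x) * (norm (f1 x /\<^sub>R (x - c)))\<^sup>2"
      using K x(2) by (simp add: m_def field_simps power2_eq_square power3_eq_cube)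
    finally show ?thesis
      using False by (simp add: curvature_radius_def f1_def f2_def d_def)
  qed
  then have "\<forall>\<^sub>F x in at c within I.
      norm (curvature_radius f I x) \<le> 4 / \<bar>K\<bar> * norm (f1 x) * (norm (f1 x /\<^sub>R (x - c)))\<^sup>2"
    using \<delta> by (auto simp: eventually_at)
  moreover have "((\<lambda>x. 4 / \<bar>K\<bar> * norm (f1 x) * (norm (f1 x /\<^sub>R (x - c)))\<^sup>2) \<longlongrightarrow> 0) (at c within I)"
  proof -
    have "((\<lambda>x. 4 / \<bar>K\<bar> * norm (f1 x) * (norm (f1 x /\<^sub>R (x - c)))\<^sup>2) \<longlongrightarrow>
      4 / \<bar>K\<bar> * norm (0 :: real^2) * (norm (f2 c))\<^sup>2) (at c within I)"
    proof (intro tendsto_intros)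
      show "(f1 \<longlongrightarrow> 0) (at c within I)"
        using has_vector_derivative_continuous[OF f1'[OF c]] by (simp add: continuous_within f1c)
      show "((\<lambda>x. f1 x /\<^sub>R (x - c)) \<longlongrightarrow> f2 c) (at c within I)"
        using f1'[OF c] by (simp add: has_vector_derivative_tendsto_quotient f1c)
    qed
    then show ?thesis by simp
  qed
  ultimately show ?thesis
    by (rule Lim_null_comparison)
qed

section \<open>Evolutoids and their front\<close>

text \<open>The vector \<open>h\<close> of the overview. It does not depend on the angle, so all
  evolutoids arise from it by rotation and scaling.\<close>

definition radius_vector :: "(real \<Rightarrow> real^2) \<Rightarrow> real set \<Rightarrow> real \<Rightarrow> real^2" where
  "radius_vector f I s = curvature_radius f I s *\<^sub>R unit_tangent f I s"

lemma evolutoid_param_eq: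
  "evolutoid_param f I \<alpha> s =
     f s + (sin \<alpha> * cos \<alpha>) *\<^sub>R radius_vector f I s + (sin \<alpha>)\<^sup>2 *\<^sub>R rot90 (radius_vector f I s)"
  by (simp add: evolutoid_param_def radius_vector_def unit_normal_def rot90_scaleR mult_ac)

text \<open>Rotating by \<open>\<beta>\<close> is rotating by \<open>\<alpha>\<close> and then by \<open>\<beta> - \<alpha>\<close>.\<close>

lemma evolutoid_param_change_angle:
  fixes f :: "real \<Rightarrow> real^2" and I :: "real set"
  assumes "sin \<alpha> \<noteq> 0"
  defines "w \<equiv> \<lambda>s. evolutoid_param f I \<alpha> s - f s"
  shows "evolutoid_param f I \<beta> s =
     f s + (sin \<beta> * cos (\<beta> - \<alpha>) / sin \<alpha>) *\<^sub>R w s + (sin \<beta> * sin (\<beta> - \<alpha>) / sin \<alpha>) *\<^sub>R rot90 (w s)"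
proof -
  define h where "h = radius_vector f I s"
  have cos: "cos \<beta> = cos (\<beta> - \<alpha>) * cos \<alpha> - sin (\<beta> - \<alpha>) * sin \<alpha>"
    using cos_add[of "\<beta> - \<alpha>" \<alpha>] by simp
  have sin: "sin \<beta> = sin (\<beta> - \<alpha>) * cos \<alpha> + cos (\<beta> - \<alpha>) * sin \<alpha>"
    using sin_add[of "\<beta> - \<alpha>" \<alpha>] by simp
  have w: "w s = sin \<alpha> *\<^sub>R (cos \<alpha> *\<^sub>R h + sin \<alpha> *\<^sub>R rot90 h)"
    by (simp add: w_def evolutoid_param_eq h_def algebra_simps power2_eq_square)
  have "(sin \<beta> * cos (\<beta> - \<alpha>) / sin \<alpha>) *\<^sub>R w s + (sin \<beta> * sin (\<beta> - \<alpha>) / sin \<alpha>) *\<^sub>R rot90 (w s)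
      = sin \<beta> *\<^sub>R (cos (\<beta> - \<alpha>) *\<^sub>R (cos \<alpha> *\<^sub>R h + sin \<alpha> *\<^sub>R rot90 h)
               + sin (\<beta> - \<alpha>) *\<^sub>R rot90 (cos \<alpha> *\<^sub>R h + sin \<alpha> *\<^sub>R rot90 h))"
    unfolding w rot90_scaleR scaleR_scaleR scaleR_add_right[of "sin \<beta>"] using assms(1) by simp
  also have "cos (\<beta> - \<alpha>) *\<^sub>R (cos \<alpha> *\<^sub>R h + sin \<alpha> *\<^sub>R rot90 h)
               + sin (\<beta> - \<alpha>) *\<^sub>R rot90 (cos \<alpha> *\<^sub>R h + sin \<alpha> *\<^sub>R rot90 h)
      = cos \<beta> *\<^sub>R h + sin \<beta> *\<^sub>R rot90 h"
    unfolding cos sin by (simp add: vec_eq_iff forall_2 algebra_simps)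
  finally show ?thesis
    by (simp add: evolutoid_param_eq h_def algebra_simps power2_eq_square)
qed

text \<open>The \<open>s\<close>-derivatives of \<open>f\<close> and of \<open>\<gamma>\<^sub>\<alpha> - f\<close> are \<open>f'\<close> and \<open>-f'\<close>, which cancel at \<open>\<beta> = \<alpha>\<close>.\<close>

lemma front_param_has_derivative_sin_nonzero:
  assumes sin: "sin \<alpha> \<noteq> 0"
    and f': "(f has_vector_derivative f') (at s within S)"
    and sing: "(evolutoid_param f I \<alpha> has_vector_derivative 0) (at s within S)"
  shows "\<exists>v. (front_param f I has_derivative (\<lambda>x. fst x *\<^sub>R v)) (at (\<alpha>, s) within A \<times> S)"
proof -
  define w where "w s = evolutoid_param f I \<alpha> s - f s" for s
  define p where "p \<beta> = sin \<beta> * cos (\<beta> - \<alpha>) / sin \<alpha>" for \<beta>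
  define q where "q \<beta> = sin \<beta> * sin (\<beta> - \<alpha>) / sin \<alpha>" for \<beta>
  \<comment> \<open>The derivative of \<open>p\<close> at \<open>\<alpha>\<close>; that of
    \<open>q\<close> is 1.\<close>
  define p' where "p' = cos \<alpha> / sin \<alpha>"
  have front: "front_param f I = (\<lambda>x. (fst x, f (snd x) + p (fst x) *\<^sub>R w (snd x) + q (fst x) *\<^sub>R rot90 (w (snd x))))"
  proof
    fix x
    show "front_param f I x =
        (fst x, f (snd x) + p (fst x) *\<^sub>R w (snd x) + q (fst x) *\<^sub>R rot90 (w (snd x)))"
      using evolutoid_param_change_angle[OF sin, of f I "fst x" "snd x"]
      by (simp only: front_param_def case_prod_unfold p_def q_def w_def)
  qed
  have w': "(w has_vector_derivative - f') (at s within S)"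
    unfolding w_def[abs_def] using has_vector_derivative_diff[OF sing f'] by simp
  let ?F = "at (\<alpha>, s) within A \<times> S"
  have snd: "((\<lambda>x. g (snd x)) has_derivative (\<lambda>x. snd x *\<^sub>R g')) ?F"
    if "(g has_vector_derivative g') (at s within S)" for g :: "real \<Rightarrow> real^2" and g'
  proof -
    have "(g has_derivative (\<lambda>t. t *\<^sub>R g')) (at (snd (\<alpha>, s)) within snd ` (A \<times> S))"
      using has_vector_derivative_within_subset[OF that, of "snd ` (A \<times> S)"]
      by (simp add: has_vector_derivative_def image_subset_iff)
    moreover have "(snd has_derivative snd) ?F"
      by (rule bounded_linear_imp_has_derivative[OF bounded_linear_snd])
    ultimately show ?thesis
      by (rule has_derivative_in_compose[rotated])
  qed
  have fst: "((\<lambda>x. g (fst x)) has_derivative (\<lambda>x. fst x * g')) ?F"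
    if "(g has_real_derivative g') (at \<alpha>)" for g g'
  proof -
    have "(g has_derivative (\<lambda>t. t * g')) (at (fst (\<alpha>, s)))"
      using that by (simp add: has_field_derivative_def mult_commute_abs)
    moreover have "(fst has_derivative fst) ?F"
      by (rule bounded_linear_imp_has_derivative[OF bounded_linear_fst])
    ultimately show ?thesis
      by (rule has_derivative_compose[rotated])
  qed
  have p: "((\<lambda>x. p (fst x)) has_derivative (\<lambda>x. fst x * p')) ?F"
    unfolding p_def[abs_def] p'_def by (rule fst) (use sin in \<open>auto intro!: derivative_eq_intros\<close>)
  have q: "((\<lambda>x. q (fst x)) has_derivative (\<lambda>x. fst x * 1)) ?F"
    unfolding q_def[abs_def] by (rule fst) (use sin in \<open>auto intro!: derivative_eq_intros\<close>)
  have Jw: "((\<lambda>x. rot90 (w (snd x))) has_derivative (\<lambda>x. snd x *\<^sub>R rot90 (- f'))) ?F"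
    by (intro snd bounded_linear.has_vector_derivative[OF bounded_linear_rot90] w')
  have p\<alpha>: "p \<alpha> = 1" and q\<alpha>: "q \<alpha> = 0"
    using sin by (simp_all add: p_def q_def)
  note sum = has_derivative_add[OF has_derivative_add[OF snd[OF f'] has_derivative_scaleR[OF p snd[OF w']]]
      has_derivative_scaleR[OF q Jw]]
  \<comment> \<open>Since \<open>p \<alpha> = 1\<close> and \<open>q \<alpha> = 0\<close>, only the
    angle direction survives; the second entry of the witness collects the derivatives of
    \<open>p\<close> and \<open>q\<close>.\<close>
  have "(front_param f I has_derivative (\<lambda>x. fst x *\<^sub>R (1, p' *\<^sub>R w s + rot90 (w s)))) ?F"
    unfolding front
    by (rule has_derivative_eq_rhs,
        rule has_derivative_Pair[OF bounded_linear_imp_has_derivative[OF bounded_linear_fst] sum])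
      (simp add: fun_eq_iff p\<alpha> q\<alpha> scaleR_right_distrib)
  then show ?thesis ..
qed

text \<open>The curve contributes derivative 0 by hypothesis. The rest is at most
  \<open>\<bar>sin \<beta>\<bar>\<close> times twice the radius, where
  \<open>\<bar>sin \<beta>\<bar> \<le> \<bar>\<beta> - \<alpha>\<bar>\<close> and the radius tends
  to 0, so it is of smaller order than the distance to \<open>(\<alpha>, s)\<close>.\<close>

lemma front_param_has_derivative_cusp:
  assumes sin: "sin \<alpha> = 0"
    and f': "(f has_vector_derivative 0) (at s within S)"
    and rad: "curvature_radius f I s = 0" "(curvature_radius f I \<longlongrightarrow> 0) (at s within S)"
  shows "\<exists>v. (front_param f I has_derivative (\<lambda>x. fst x *\<^sub>R v)) (at (\<alpha>, s) within A \<times> S)"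
proof -
  let ?F = "at (\<alpha>, s) within A \<times> S"
  define h where "h = radius_vector f I"
  define g where "g x = (sin (fst x) * cos (fst x)) *\<^sub>R h (snd x) + (sin (fst x))\<^sup>2 *\<^sub>R rot90 (h (snd x))"
    for x :: "real \<times> real"
  \<comment> \<open>The factor 2 accounts for the two summands of \<open>g\<close>, in each of which
    one factor \<open>cos\<close> or \<open>sin\<close> is bounded by 1.\<close>
  define r where "r x = 2 * \<bar>curvature_radius f I (snd x)\<bar>" for x :: "real \<times> real"
  have h_le: "norm (h t) \<le> \<bar>curvature_radius f I t\<bar>" for t
    by (simp add: h_def radius_vector_def unit_tangent_def norm_sgn)
  \<comment> \<open>As \<open>sin \<alpha> = 0\<close>, shifting by \<open>\<alpha>\<close> changes
    the sine by a sign at most.\<close>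
  have sin_le: "\<bar>sin \<beta>\<bar> \<le> \<bar>\<beta> - \<alpha>\<bar>" for \<beta>
  proof -
    have "cos \<alpha> = 1 \<or> cos \<alpha> = -1"
      using sin sin_zero_abs_cos_one by fastforce
    then have "\<bar>sin \<beta>\<bar> = \<bar>sin (\<beta> - \<alpha>)\<bar>"
      using sin by (auto simp: sin_diff)
    then show ?thesis
      using abs_sin_x_le_abs_x[of "\<beta> - \<alpha>"] by simp
  qed
  have "(g has_derivative (\<lambda>_. 0)) ?F"
  proof (rule has_derivative_zero_if_bounded)
    show "g (\<alpha>, s) = 0"
      by (simp add: g_def sin)
    show "norm (g x) \<le> norm (x - (\<alpha>, s)) * r x" for x
    proof -
      have "norm (g x) \<le> \<bar>sin (fst x)\<bar> * \<bar>cos (fst x)\<bar> * norm (h (snd x)) + \<bar>sin (fst x)\<bar> * \<bar>sin (fst x)\<bar> * norm (h (snd x))"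
        unfolding g_def by (rule order.trans[OF norm_triangle_ineq]) (simp add: abs_mult power2_eq_square)
      also have "\<dots> \<le> \<bar>sin (fst x)\<bar> * 1 * norm (h (snd x)) + \<bar>sin (fst x)\<bar> * 1 * norm (h (snd x))"
        by (intro add_mono mult_right_mono mult_left_mono) auto
      also have "\<dots> = \<bar>sin (fst x)\<bar> * (2 * norm (h (snd x)))"
        by simp
      also have "\<dots> \<le> norm (x - (\<alpha>, s)) * r x"
      proof (rule mult_mono)
        have "\<bar>fst x - \<alpha>\<bar> \<le> norm (x - (\<alpha>, s))"
          using norm_fst_le[of "fst x - \<alpha>" "snd x - s"] by (cases x) simp
        with sin_le[of "fst x"] show "\<bar>sin (fst x)\<bar> \<le> norm (x - (\<alpha>, s))"
          by linarith
      qed (use h_le in \<open>auto simp: r_def\<close>)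
      finally show ?thesis .
    qed
    \<comment> \<open>The value at \<open>s\<close> matters along with the limit: a pair
      \<open>(\<beta>, s)\<close> with \<open>\<beta> \<noteq> \<alpha>\<close> differs from
      \<open>(\<alpha>, s)\<close> but is projected to \<open>s\<close> itself.\<close>
    have cont: "continuous (at (snd (\<alpha>, s)) within snd ` (A \<times> S)) (curvature_radius f I)"
      using tendsto_within_subset[OF rad(2), of "snd ` (A \<times> S)"] rad(1)
      by (simp add: continuous_within image_subset_iff)
    have "continuous ?F (\<lambda>x. curvature_radius f I (snd x))"
      by (rule continuous_within_compose2[OF _ cont]) (intro continuous_intros)
    then have "((\<lambda>x. curvature_radius f I (snd x)) \<longlongrightarrow> 0) ?F"
      using rad(1) by (simp add: continuous_within)
    then show "(r \<longlongrightarrow> 0) ?F"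
      unfolding r_def[abs_def] by (auto intro!: tendsto_eq_intros)
  qed
  moreover have "((\<lambda>x. f (snd x)) has_derivative (\<lambda>_. 0)) ?F"
  proof -
    have "(f has_derivative (\<lambda>_. 0)) (at (snd (\<alpha>, s)) within snd ` (A \<times> S))"
      using has_vector_derivative_within_subset[OF f', of "snd ` (A \<times> S)"]
      by (simp add: has_vector_derivative_def image_subset_iff)
    moreover have "(snd has_derivative snd) ?F"
      by (rule bounded_linear_imp_has_derivative[OF bounded_linear_snd])
    ultimately show ?thesis
      by (rule has_derivative_in_compose[rotated])
  qed
  moreover have "front_param f I = (\<lambda>x. (fst x, f (snd x) + g x))"
    by (simp add: front_param_def evolutoid_param_eq g_def h_def case_prod_unfold fun_eq_iff)
  ultimately have "(front_param f I has_derivative (\<lambda>x. fst x *\<^sub>R (1, 0))) ?F"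
    by (auto intro!: derivative_eq_intros)
  then show ?thesis ..
qed

section \<open>From singular points of an evolutoid to singular points of the front\<close>

text \<open>The determinant is continuous and nonzero at \<open>s\<close>, so no inflection lies
  near \<open>s\<close> and the domain agrees there with \<open>I\<close>.\<close>

lemma at_within_finite_radius_domain:
  assumes "smooth_curve f I" and "s \<in> finite_radius_domain f I" and "curve_deriv f I 1 s \<noteq> 0"
  shows "at s within finite_radius_domain f I = at s within I"
proof -
  have s: "s \<in> I" and det: "det2 (curve_deriv f I 1 s) (curve_deriv f I 2 s) \<noteq> 0"
    using assms(2,3) by (auto simp: finite_radius_domain_def)
  have "(curve_deriv f I n \<longlongrightarrow> curve_deriv f I n s) (at s within I)" for n
    using has_vector_derivative_continuous[OF has_vector_derivative_curve_deriv[OF assms(1) s]]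
    by (simp only: continuous_within)
  then have "((\<lambda>x. det2 (curve_deriv f I 1 x) (curve_deriv f I 2 x)) \<longlongrightarrow>
      det2 (curve_deriv f I 1 s) (curve_deriv f I 2 s)) (at s within I)"
    by (intro tendsto_det2)
  then have "\<forall>\<^sub>F x in at s within I. det2 (curve_deriv f I 1 x) (curve_deriv f I 2 x) \<noteq> 0"
    using det by (rule tendsto_imp_eventually_ne)
  then have "\<exists>U. open U \<and> s \<in> U \<and>
      (\<forall>x\<in>U. x \<noteq> s \<longrightarrow> x \<in> I \<longrightarrow> det2 (curve_deriv f I 1 x) (curve_deriv f I 2 x) \<noteq> 0)"
    by (simp only: eventually_at_topological)
  then obtain U where "open U" "s \<in> U"
    and U: "\<And>x. x \<in> U \<Longrightarrow> x \<noteq> s \<Longrightarrow> x \<in> I \<Longrightarrow> det2 (curve_deriv f I 1 x) (curve_deriv f I 2 x) \<noteq> 0"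
    by blast
  show ?thesis
    by (rule at_within_nhd[OF \<open>s \<in> U\<close> \<open>open U\<close>]) (use U in \<open>auto simp: finite_radius_domain_def\<close>)
qed

lemma front_param_has_derivative_singular:
  assumes smooth: "smooth_curve f I" and cusps: "at_most_cusps f I"
    and s: "s \<in> finite_radius_domain f I"
    and sing: "(evolutoid_param f I \<alpha> has_vector_derivative 0) (at s within finite_radius_domain f I)"
  shows "\<exists>v. (front_param f I has_derivative (\<lambda>x. fst x *\<^sub>R v)) (at (\<alpha>, s) within A \<times> finite_radius_domain f I)"
proof -
  let ?D = "finite_radius_domain f I"
  have "s \<in> I" and sub: "?D \<subseteq> I"
    using s by (auto simp: finite_radius_domain_def)
  have f'I: "(f has_vector_derivative curve_deriv f I 1 s) (at s within I)"
    using has_vector_derivative_curve_deriv[OF smooth \<open>s \<in> I\<close>, of 0] by simp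
  then have f'D: "(f has_vector_derivative curve_deriv f I 1 s) (at s within ?D)"
    using sub by (rule has_vector_derivative_within_subset)
  show ?thesis
  proof (cases "sin \<alpha> = 0")
    case False
    then show ?thesis
      using f'D sing by (rule front_param_has_derivative_sin_nonzero)
  next
    case True
    then have "evolutoid_param f I \<alpha> = f"
      by (simp add: evolutoid_param_def fun_eq_iff)
    with sing have f0: "(f has_vector_derivative 0) (at s within ?D)"
      by simp
    have f1: "curve_deriv f I 1 s = 0"
    \<comment> \<open>A derivative within the domain need not be unique if its point is isolated
      there. With nonzero velocity the domain can be replaced by the interval, where uniqueness
      holds.\<close>
    proof (rule ccontr)
      assume ne: "curve_deriv f I 1 s \<noteq> 0"
      have "(f has_vector_derivative 0) (at s within I)"
        using f0 by (simp only: at_within_finite_radius_domain[OF smooth s ne])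
      then have "curve_deriv f I 1 s = 0"
        using vector_derivative_unique_within[OF at_within_smooth_curve_nonbot[OF smooth \<open>s \<in> I\<close>] f'I]
        by simp
      with ne show False ..
    qed
    then have "is_cusp f I s"
      using cusps \<open>s \<in> I\<close> by (simp add: at_most_cusps_def)
    then have "(curvature_radius f I \<longlongrightarrow> 0) (at s within ?D)"
      by (rule tendsto_within_subset[OF curvature_radius_tendsto_0_at_cusp[OF smooth \<open>s \<in> I\<close>] sub])
    moreover have "curvature_radius f I s = 0"
      using f1 by (simp add: curvature_radius_def)
    ultimately show ?thesis
      using True f0 by (intro front_param_has_derivative_cusp)
  qed
qed

section \<open>From singular points of the front to singular points of an evolutoid\<close>

text \<open>Along the two axes \<open>F\<close> yields \<open>F (1, 0)\<close> with first entry 1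
  and, unless \<open>s\<close> is isolated, \<open>F (0, 1)\<close> with first entry 0. A nonzero
  \<open>F (0, 1)\<close> would be independent of \<open>F (1, 0)\<close> and force rank 2; hence it
  vanishes, and its second entry is the derivative of the evolutoid.\<close>

lemma evolutoid_param_singular_if_front_singular:
  assumes F: "(front_param f I has_derivative F) (at (\<alpha>, s) within {0..pi} \<times> S)"
    and dim: "dim (range F) < 2" and \<alpha>: "\<alpha> \<in> {0..pi}" and s: "s \<in> S"
  shows "(evolutoid_param f I \<alpha> has_vector_derivative 0) (at s within S)"
proof -
  have lin: "linear F"
    using F has_derivative_linear by blast
  have in\<alpha>: "((\<lambda>\<beta>. (\<beta>, s)) has_derivative (\<lambda>t. (t, 0))) (at \<alpha> within {0..pi})"
    by (intro has_derivative_Pair has_derivative_const has_derivative_ident)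
  have ins: "(Pair \<alpha> has_derivative Pair 0) (at s within S)"
    by (intro has_derivative_Pair has_derivative_const has_derivative_ident)
  have along_\<alpha>: "((\<lambda>\<beta>. front_param f I (\<beta>, s)) has_derivative (\<lambda>t. F (t, 0))) (at \<alpha> within {0..pi})"
    by (rule has_derivative_in_compose[OF in\<alpha>], rule has_derivative_subset[OF F]) (use s in auto)
  have along_s: "((\<lambda>t. front_param f I (\<alpha>, t)) has_derivative (\<lambda>t. F (0, t))) (at s within S)"
    by (rule has_derivative_in_compose[OF ins], rule has_derivative_subset[OF F]) (use \<alpha> in auto)
  have F10: "fst (F (1, 0)) = 1"
  proof -
    have "((\<lambda>\<beta>. \<beta>) has_derivative (\<lambda>t. fst (F (t, 0)))) (at \<alpha> within {0..pi})"
      using has_derivative_fst[OF along_\<alpha>] by (simp add: front_param_def)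
    moreover have "(\<lambda>t. fst (F (t, 0))) = (\<lambda>t. t *\<^sub>R fst (F (1, 0)))"
    proof
      show "fst (F (t, 0)) = t *\<^sub>R fst (F (1, 0))" for t
        using linear_cmul[OF lin, of t "(1, 0)"] by simp
    qed
    ultimately have "((\<lambda>\<beta>. \<beta>) has_vector_derivative fst (F (1, 0))) (at \<alpha> within {0..pi})"
      unfolding has_vector_derivative_def by (simp only:)
    moreover have "((\<lambda>\<beta>. \<beta>) has_vector_derivative 1) (at \<alpha> within {0..pi})"
      by simp
    \<comment> \<open>The angle may be 0 or \<open>pi\<close>; the one-sided derivative at an end
      point is still unique.\<close>
    moreover have "at \<alpha> within {0..pi} \<noteq> bot"
      using \<alpha> by (simp add: trivial_limit_within)
    ultimately show ?thesis
      by (rule vector_derivative_unique_within[rotated])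
  qed
  have F01: "(\<lambda>t. F (0, t)) = (\<lambda>t. t *\<^sub>R F (0, 1))"
  proof
    show "F (0, t) = t *\<^sub>R F (0, 1)" for t
      using linear_cmul[OF lin, of t "(0, 1)"] by simp
  qed
  have along_s_vector: "((\<lambda>t. front_param f I (\<alpha>, t)) has_vector_derivative F (0, 1)) (at s within S)"
    using along_s unfolding has_vector_derivative_def F01 .
  show ?thesis
  \<comment> \<open>At an isolated parameter every vector is a derivative, so 0 is one as
    well.\<close>
  proof (cases "at s within S = bot")
    case True
    then show ?thesis
      unfolding has_vector_derivative_tendsto_quotient by simp
  next
    case False
    have "((\<lambda>t. \<alpha>) has_vector_derivative fst (F (0, 1))) (at s within S)"
      using bounded_linear.has_vector_derivative[OF bounded_linear_fst along_s_vector]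
      by (simp add: front_param_def)
    then have fst0: "fst (F (0, 1)) = 0"
      by (rule vector_derivative_unique_within[OF False]) simp
    have "F (0, 1) = 0"
    proof (rule ccontr)
      assume ne: "F (0, 1) \<noteq> 0"
      have notin: "F (1, 0) \<notin> span {F (0, 1)}"
        using F10 fst0 by (auto simp: span_singleton)
      then have "F (1, 0) \<noteq> F (0, 1)"
        by (auto simp: span_base)
      then have "card {F (1, 0), F (0, 1)} = 2"
        by simp
      moreover have "independent {F (1, 0), F (0, 1)}"
        using notin ne by (simp add: independent_insert)
      ultimately have "2 \<le> dim (range F)"
        by (metis independent_card_le_dim empty_subsetI insert_subset rangeI)
      with dim show False by simp
    qed
    then show ?thesis
      using bounded_linear.has_vector_derivative[OF bounded_linear_snd along_s_vector]
      by (simp add: front_param_def)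
  qed
qed

theorem proposition4p2:
  fixes f :: "real \<Rightarrow> real^2" and I :: "real set"
  assumes "smooth_curve f I" and "at_most_cusps f I"
  shows "snd ` front_singular_points f I = SES f I"
proof
  show "snd ` front_singular_points f I \<subseteq> SES f I"
  proof clarify
    fix a x assume "(a, x) \<in> front_singular_points f I"
    then obtain \<alpha> s F where \<alpha>: "\<alpha> \<in> {0..pi}" and s: "s \<in> finite_radius_domain f I"
      and x: "x = evolutoid_param f I \<alpha> s"
      and F: "(front_param f I has_derivative F) (at (\<alpha>, s) within {0..pi} \<times> finite_radius_domain f I)"
      and dim: "dim (range F) < 2"
      by (auto simp: front_singular_points_def front_domain_def front_param_def)
    have "(evolutoid_param f I \<alpha> has_vector_derivative 0) (at s within finite_radius_domain f I)"
      using F dim \<alpha> s by (rule evolutoid_param_singular_if_front_singular)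
    then have "x \<in> evolutoid_singular_points f I \<alpha>"
      using s x by (auto simp: evolutoid_singular_points_def evolutoid_def)
    with \<alpha> show "snd (a, x) \<in> SES f I"
      by (auto simp: SES_def)
  qed
  show "SES f I \<subseteq> snd ` front_singular_points f I"
  proof
    fix x assume "x \<in> SES f I"
    then obtain \<alpha> s where \<alpha>: "\<alpha> \<in> {0..pi}" and s: "s \<in> finite_radius_domain f I"
      and x: "x = evolutoid_param f I \<alpha> s"
      and sing: "(evolutoid_param f I \<alpha> has_vector_derivative 0) (at s within finite_radius_domain f I)"
      by (auto simp: SES_def evolutoid_singular_points_def)
    \<comment> \<open>A differential of this form depends on the angle direction only, so its range
      lies on one line.\<close>
    obtain v where v: "(front_param f I has_derivative (\<lambda>x. fst x *\<^sub>R v))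
        (at (\<alpha>, s) within {0..pi} \<times> finite_radius_domain f I)"
      using front_param_has_derivative_singular[OF assms s sing] by blast
    have q: "(\<alpha>, s) \<in> front_domain f I"
      using \<alpha> s by (simp add: front_domain_def)
    have "dim (range (\<lambda>x :: real \<times> real. fst x *\<^sub>R v)) < 2"
      by (rule le_less_trans[OF dim_range_scaleR_le_1]) simp
    then have "front_param f I (\<alpha>, s) \<in> front_singular_points f I"
      unfolding front_singular_points_def extended_front_eq_image
      using q v[folded front_domain_def] by blast
    moreover have "x = snd (front_param f I (\<alpha>, s))"
      by (simp add: x front_param_def)
    ultimately show "x \<in> snd ` front_singular_points f I"
      by blast
  qed
qed

end
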